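(* Let $X$ be an Hadamard space with linear dual space $X^{\lozenge}$ and let $M\subseteq X\times X^{\lozenge}$. Then the following statements are equivalent: (i) $M$ is monotone; (ii) $M\subseteq M^{\mu}$; (iii) $M^{\mu\mu}\subseteq M^{\mu}$; (iv) $M^{\mu\mu}$ is monotone. In addition, $M$ is a maximal monotone set if and only if $M=M^{\mu}$. Moreover, every maximal monotone set in $X\times X^{\lozenge}$ is $\mu$-closed.
   Context: An Hadamard space is a complete $\mathrm{CAT}(0)$ space $(X,d)$. For $a,b\in X$ write $\overrightarrow{ab}$ for the ordered pair $(a,b)\in X^2$. The quasilinearization is $\langle\overrightarrow{ab},\overrightarrow{cd}\rangle:=\frac12\big(d(a,d)^2+d(b,c)^2-d(a,c)^2-d(b,d)^2\big)$. The dual space $X^*$ is the set of equivalence classes $[t\overrightarrow{ab}]$ of triples $(t,a,b)\in\mathbb{R}\times X^2$, where $(t,a,b)\sim(s,c,d)$ iff $t\langle\overrightarrow{ab},\overrightarrow{xy}\rangle=s\langle\overrightarrow{cd},\overrightarrow{xy}\rangle$ for all $x,y\in X$; it acts on $X^2$ by $\langle[t\overrightarrow{ab}],\overrightarrow{xy}\rangle=t\langle\overrightarrow{ab},\overrightarrow{xy}\rangle$. The linear dual space $X^{\lozenge}=\mathrm{span}\,X^*$ is the vector space of finite linear combinations $\sum_i\alpha_ix_i^*$ ($\alpha_i\in\mathbb{R}$, $x_i^*\in X^*$), identified with the functions they define on $X^2$ by $\langle\sum_i\alpha_ix_i^*,\overrightarrow{xy}\rangle=\sum_i\alpha_i\langle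 x_i^*,\overrightarrow{xy}\rangle$. Elements $(x,x^{\lozenge}),(y,y^{\lozenge})\in X\times X^{\lozenge}$ are monotonically related, written $(x,x^{\lozenge})\,\mu\,(y,y^{\lozenge})$, if $\langle x^{\lozenge}-y^{\lozenge},\overrightarrow{yx}\rangle\ge 0$. A set $M\subseteq X\times X^{\lozenge}$ is monotone if any two of its elements are monotonically related; a monotone set is maximal if no monotone set properly contains it. The monotone polar of $M\subseteq X\times X^{\lozenge}$ is $M^{\mu}:=\{(x,x^{\lozenge})\in X\times X^{\lozenge}: (x,x^{\lozenge})\,\mu\,(y,y^{\lozenge})\ \text{for all } (y,y^{\lozenge})\in M\}$, and $M^{\mu\mu}:=(M^{\mu})^{\mu}$. The set $M$ is called $\mu$-closed if $M^{\mu\mu}=M$. *)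

theory Defs
  imports "HOL-Analysis.Analysis"
begin

definition geodesic_segment :: "'a::metric_space set \<Rightarrow> 'a \<Rightarrow> 'a \<Rightarrow> bool" where
  "geodesic_segment S x y \<longleftrightarrow>
     (\<exists>c l. 0 \<le> (l::real) \<and> c 0 = x \<and> c l = y \<and> S = c ` {0..l} \<and>
        (\<forall>s\<in>{0..l}. \<forall>t\<in>{0..l}. dist (c s) (c t) = \<bar>s - t\<bar>))"

(* Each geodesic triangle is at least as thin as its comparison triangle p' q' r' in the
   Euclidean plane.  Points on two different sides always lie on two sides with a common vertex,
   here called p; since p, q, r and the segments are arbitrary, all pairs of sides are covered.
   For two points on the same side the comparison inequality is trivial. *)
class hadamard_space = complete_space +
  assumes geodesic_space: "\<exists>S. geodesic_segment S x y"
    and cat0_inequality: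
      "\<lbrakk>geodesic_segment S p q; geodesic_segment T p r;
        dist (p'::real^2) q' = dist p q; dist p' r' = dist p r; dist q' r' = dist q r;
        x \<in> S; x' \<in> closed_segment p' q'; dist p' x' = dist p x;
        y \<in> T; y' \<in> closed_segment p' r'; dist p' y' = dist p y\<rbrakk>
       \<Longrightarrow> dist x y \<le> dist x' y'"

definition quasilin :: "'a::metric_space \<times> 'a \<Rightarrow> 'a \<times> 'a \<Rightarrow> real" where
  "quasilin = (\<lambda>(a, b) (c, d).
     ((dist a d)\<^sup>2 + (dist b c)\<^sup>2 - (dist a c)\<^sup>2 - (dist b d)\<^sup>2) / 2)"

definition dual_rel :: "((real \<times> 'a::metric_space \<times> 'a) \<times> (real \<times> 'a \<times> 'a)) set" where
  "dual_rel = {((t, a, b), (s, c, d)).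
     \<forall>x y. t * quasilin (a, b) (x, y) = s * quasilin (c, d) (x, y)}"

lemma equiv_dual_rel: "equiv UNIV dual_rel"
  by (rule equivI) (auto simp: dual_rel_def refl_on_def sym_def trans_def)

definition dual_space :: "(real \<times> 'a::metric_space \<times> 'a) set set" where
  "dual_space = UNIV // dual_rel"

definition dual_act :: "(real \<times> 'a::metric_space \<times> 'a) set \<Rightarrow> 'a \<times> 'a \<Rightarrow> real" where
  "dual_act \<xi> p = the_elem ((\<lambda>(t, a, b). t * quasilin (a, b) p) ` \<xi>)"

lemma dual_act_class: "dual_act (dual_rel `` {(t, a, b)}) p = t * quasilin (a, b) p"
proof -
  have "(\<lambda>(t, a, b). t * quasilin (a, b) p) ` (dual_rel `` {(t, a, b)})
      = {t * quasilin (a, b) p}"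
    by (cases p) (force simp: dual_rel_def image_iff)
  then show ?thesis
    by (simp add: dual_act_def)
qed

(* Linear combinations of elements of the dual space are identified with the functions they
   define on pairs of points; the pairing of f with the pair xy is then just f (x, y). *)
definition linear_dual :: "('a::metric_space \<times> 'a \<Rightarrow> real) set" where
  "linear_dual = {f. \<exists>(n::nat) \<alpha> \<xi>. (\<forall>i<n. \<xi> i \<in> dual_space) \<and>
     f = (\<lambda>p. \<Sum>i<n. \<alpha> i * dual_act (\<xi> i) p)}"

definition mono_related ::
  "'a::metric_space \<times> ('a \<times> 'a \<Rightarrow> real) \<Rightarrow> 'a \<times> ('a \<times> 'a \<Rightarrow> real) \<Rightarrow> bool" where
  "mono_related = (\<lambda>(x, f) (y, g). (f - g) (y, x) \<ge> 0)"

definition monotone_set :: "('a::metric_space \<times> ('a \<times> 'a \<Rightarrow> real)) set \<Rightarrow> bool" where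
  "monotone_set M \<longleftrightarrow>
     M \<subseteq> UNIV \<times> linear_dual \<and> (\<forall>u\<in>M. \<forall>v\<in>M. mono_related u v)"

definition maximal_monotone_set :: "('a::metric_space \<times> ('a \<times> 'a \<Rightarrow> real)) set \<Rightarrow> bool" where
  "maximal_monotone_set M \<longleftrightarrow> monotone_set M \<and> \<not> (\<exists>N. monotone_set N \<and> M \<subset> N)"

definition mu_polar ::
  "('a::metric_space \<times> ('a \<times> 'a \<Rightarrow> real)) set \<Rightarrow> ('a \<times> ('a \<times> 'a \<Rightarrow> real)) set" where
  "mu_polar M = {u \<in> UNIV \<times> linear_dual. \<forall>v\<in>M. mono_related u v}"

definition mu_closed :: "('a::metric_space \<times> ('a \<times> 'a \<Rightarrow> real)) set \<Rightarrow> bool" where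
  "mu_closed M \<longleftrightarrow> mu_polar (mu_polar M) = M"

end

theory Submission
  imports Defs
begin

text \<open>
  Functions in the linear dual are antisymmetric on pairs of points, so being monotonically related
  is a symmetric relation, and it is trivially reflexive. Hence the polar is an antitone Galois
  connection with itself, which gives \<open>M \<subseteq> M\<^sup>\<mu>\<^sup>\<mu>\<close> and \<open>M\<^sup>\<mu>\<^sup>\<mu>\<^sup>\<mu> = M\<^sup>\<mu>\<close>; reflexivity
  shows that a monotone set can be enlarged by any single point of its polar.
\<close>

lemma quasilin_swap: "quasilin p (y, x) = - quasilin p (x, y)"
  by (cases p) (simp add: quasilin_def field_simps)

lemma dual_act_swap:
  assumes "\<xi> \<in> dual_space"
  shows "dual_act \<xi> (y, x) = - dual_act \<xi> (x, y)"
proof -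
  obtain t a b where "\<xi> = dual_rel `` {(t, a, b)}"
    using assms unfolding dual_space_def by (auto elim!: quotientE)
  then show ?thesis
    by (simp add: dual_act_class quasilin_swap[of _ y x])
qed

text \<open>The sign change of \<open>quasilin\<close> under exchange of the endpoints passes to
  classes and then, term by term, to finite linear combinations.\<close>

lemma linear_dual_swap:
  assumes "f \<in> linear_dual"
  shows "f (y, x) = - f (x, y)"
proof -
  obtain n :: nat and \<alpha> \<xi> where \<xi>: "\<forall>i<n. \<xi> i \<in> dual_space"
    and f: "f = (\<lambda>p. \<Sum>i<n. \<alpha> i * dual_act (\<xi> i) p)"
    using assms unfolding linear_dual_def by blast
  have "(\<Sum>i<n. \<alpha> i * dual_act (\<xi> i) (y, x)) = (\<Sum>i<n. - (\<alpha> i * dual_act (\<xi> i) (x, y)))"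
    using \<xi> by (intro sum.cong refl) (simp add: dual_act_swap[of _ y x])
  then show ?thesis
    unfolding f by (simp add: sum_negf)
qed

lemma mono_related_refl: "mono_related u u"
  by (cases u) (simp add: mono_related_def)

text \<open>Exchanging \<open>u\<close> and \<open>v\<close> negates the difference
  \<open>f - g\<close> and reverses the pair of points; by antisymmetry the two signs
  cancel.\<close>

lemma mono_related_sym:
  assumes "u \<in> UNIV \<times> linear_dual" "v \<in> UNIV \<times> linear_dual" "mono_related u v"
  shows "mono_related v u"
proof -
  obtain x f y g where "u = (x, f)" "v = (y, g)" by (cases u, cases v)
  with assms show ?thesis
    by (simp add: mono_related_def linear_dual_swap[of _ y x])
qed

lemma mu_polar_subset: "mu_polar M \<subseteq> UNIV \<times> linear_dual"
  by (auto simp: mu_polar_def)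

lemma mu_polar_antimono: "M \<subseteq> N \<Longrightarrow> mu_polar N \<subseteq> mu_polar M"
  by (auto simp: mu_polar_def)

lemma subset_mu_polar_mu_polar:
  assumes "M \<subseteq> UNIV \<times> linear_dual"
  shows "M \<subseteq> mu_polar (mu_polar M)"
proof
  fix u assume u: "u \<in> M"
  have "mono_related u v" if "v \<in> mu_polar M" for v
    using that u assms by (intro mono_related_sym[of v u]) (auto simp: mu_polar_def)
  then show "u \<in> mu_polar (mu_polar M)"
    using u assms unfolding mu_polar_def[of "mu_polar M"] by blast
qed

lemma mu_polar_mu_polar_mu_polar:
  assumes "M \<subseteq> UNIV \<times> linear_dual"
  shows "mu_polar (mu_polar (mu_polar M)) = mu_polar M"
  \<comment> \<open>One inclusion reverses \<open>M \<subseteq> mu_polar (mu_polar M)\<close>; the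
    other is that same fact with \<open>mu_polar M\<close> in place of \<open>M\<close>.\<close>
  using mu_polar_antimono[OF subset_mu_polar_mu_polar[OF assms]]
    subset_mu_polar_mu_polar[OF mu_polar_subset] by (rule subset_antisym)

lemma monotone_set_iff_subset_mu_polar:
  assumes "M \<subseteq> UNIV \<times> linear_dual"
  shows "monotone_set M \<longleftrightarrow> M \<subseteq> mu_polar M"
  using assms unfolding monotone_set_def mu_polar_def by blast

lemma monotone_set_insert:
  assumes "monotone_set M" "u \<in> mu_polar M"
  shows "monotone_set (insert u M)"
  using assms mono_related_refl[of u] mono_related_sym[of u]
  unfolding monotone_set_def mu_polar_def by blast

lemma maximal_monotone_set_iff_eq_mu_polar:
  "maximal_monotone_set M \<longleftrightarrow> M = mu_polar M"
proof
  assume max: "maximal_monotone_set M"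
  then have mono: "monotone_set M" by (simp add: maximal_monotone_set_def)
  then have "M \<subseteq> mu_polar M"
    by (auto simp: monotone_set_def mu_polar_def)
  \<comment> \<open>A point of the polar outside \<open>M\<close> could be inserted, giving a
    strictly larger monotone set.\<close>
  moreover have "mu_polar M \<subseteq> M"
    using max monotone_set_insert[OF mono] unfolding maximal_monotone_set_def by blast
  ultimately show "M = mu_polar M" ..
next
  assume eq: "M = mu_polar M"
  then have "M \<subseteq> UNIV \<times> linear_dual" using mu_polar_subset by blast
  then have "monotone_set M"
    using eq monotone_set_iff_subset_mu_polar by blast
  \<comment> \<open>Any monotone extension is squeezed:
    \<open>N \<subseteq> mu_polar N \<subseteq> mu_polar M = M\<close>.\<close>
  moreover have "N \<subseteq> M" if N: "monotone_set N" "M \<subseteq> N" for N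
  proof -
    have "N \<subseteq> mu_polar N"
      using N(1) by (auto simp: monotone_set_def mu_polar_def)
    also have "\<dots> \<subseteq> M"
      using mu_polar_antimono[OF N(2)] eq by simp
    finally show ?thesis .
  qed
  ultimately show "maximal_monotone_set M"
    unfolding maximal_monotone_set_def by blast
qed

theorem proposition3p16:
  fixes M :: "('a::hadamard_space \<times> ('a \<times> 'a \<Rightarrow> real)) set"
  assumes "M \<subseteq> UNIV \<times> linear_dual"
  shows "((monotone_set M \<longleftrightarrow> M \<subseteq> mu_polar M) \<and>
          (M \<subseteq> mu_polar M \<longleftrightarrow> mu_polar (mu_polar M) \<subseteq> mu_polar M) \<and>
          (mu_polar (mu_polar M) \<subseteq> mu_polar M \<longleftrightarrow> monotone_set (mu_polar (mu_polar M)))) \<and>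
         (maximal_monotone_set M \<longleftrightarrow> M = mu_polar M) \<and>
         (\<forall>N :: ('a \<times> ('a \<times> 'a \<Rightarrow> real)) set. maximal_monotone_set N \<longrightarrow> mu_closed N)"
proof (intro conjI allI impI)
  show "monotone_set M \<longleftrightarrow> M \<subseteq> mu_polar M"
    using assms by (rule monotone_set_iff_subset_mu_polar)
  \<comment> \<open>Forwards, take polars of both sides; backwards, chain with
    \<open>M \<subseteq> mu_polar (mu_polar M)\<close>.\<close>
  show "M \<subseteq> mu_polar M \<longleftrightarrow> mu_polar (mu_polar M) \<subseteq> mu_polar M"
    using subset_mu_polar_mu_polar[OF assms] mu_polar_antimono by blast
  \<comment> \<open>The first equivalence, applied to the bipolar, compares it with the triple
    polar, which collapses to \<open>mu_polar M\<close>.\<close>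
  show "mu_polar (mu_polar M) \<subseteq> mu_polar M \<longleftrightarrow> monotone_set (mu_polar (mu_polar M))"
    by (simp add: monotone_set_iff_subset_mu_polar[OF mu_polar_subset]
        mu_polar_mu_polar_mu_polar[OF assms])
  show "maximal_monotone_set M \<longleftrightarrow> M = mu_polar M"
    by (rule maximal_monotone_set_iff_eq_mu_polar)
  show "mu_closed N" if "maximal_monotone_set N" for N :: "('a \<times> ('a \<times> 'a \<Rightarrow> real)) set"
    using that unfolding maximal_monotone_set_iff_eq_mu_polar mu_closed_def by simp
qed

end
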